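(* Let $L$ be a finite compatibly dismantlable lattice. Every $x\in L$ is uniquely determined by its downward label set $\mathcal{D}_L(x)$ and also by its upward label set $\mathcal{U}_L(x)$; more precisely, $x=\bigvee\mathcal{D}_L(x)=\bigwedge\kappa_L(\mathcal{U}_L(x))$.
   Context: All lattices are finite. For a lattice $L$, $\mathcal{J}_L$ (resp. $\mathcal{M}_L$) is the set of join-irreducible (resp. meet-irreducible) elements; for $j\in\mathcal{J}_L$, $j_*$ is the unique element covered by $j$, and for $m\in\mathcal{M}_L$, $m^*$ is the unique element covering $m$. Let $\mathcal{M}_L(j)=\max\{z\in L: j_*=j\wedge z\}$ and $\mathcal{J}_L(m)=\min\{z\in L: m^*=m\vee z\}$. A pairing on $L$ is a bijection $\kappa:\mathcal{J}_L\to\mathcal{M}_L$ with $\kappa(j)\in\mathcal{M}_L(j)$ for all $j$ and $\kappa^{-1}(m)\in\mathcal{J}_L(m)$ for all $m$; $L$ is uniquely paired if it has exactly one pairing, denoted $\kappa_L$. A prime pair is a pair $(j_0,m_0)$ with $L=[\hat0,m_0]\sqcup[j_0,\hat1]$. A uniquely paired lattice $L$ is compatibly dismantlable if $|L|=1$ or there is a prime pair $(j_0,m_0)$ such that: (i) $[j_0,\hat1]$ is compatibly dismantlable and $\alpha(j)=j_0\vee j$ defines a bijection $\{j\in\mathcal{J}_L: j_0\le\kappa_L(j)\}\to\mathcal{J}_{[j_0,\hat1]}$ with $\kappa_{[j_0,\hat1]}(\alpha(j))=\kappa_L(j)$; (ii) $[\hat0,m_0]$ is compatibly dismantlable and $\beta(m)=m_0\wedge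 m$ defines a bijection $\{m\in\mathcal{M}_L:\kappa_L^{-1}(m)\le m_0\}\to\mathcal{M}_{[\hat0,m_0]}$ with $\kappa_{[\hat0,m_0]}^{-1}(\beta(m))=\kappa_L^{-1}(m)$. For $x\in L$ let $J_L(x)=\{j\in\mathcal{J}_L:j\le x\}$ and $M_L(x)=\{j\in\mathcal{J}_L:\kappa_L(j)\ge x\}$. In a compatibly dismantlable $L$, for every cover $x\lessdot y$ the set $M_L(x)\cap J_L(y)$ has exactly one element $j_{xy}$; set $\mathcal{D}_L(x)=\{j_{yx}:y\lessdot x\}$ and $\mathcal{U}_L(x)=\{j_{xy}:x\lessdot y\}$, and $\kappa_L(S)=\{\kappa_L(j):j\in S\}$. *)

theory Defs
  imports "HOL-Algebra.Lattice" "HOL-Library.FuncSet"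
begin

text \<open>
  Lattices are \<open>gorder\<close> structures with an explicit carrier, so that every notion below
  applies verbatim to the intervals of a lattice, viewed as lattices in their own right.
\<close>

locale finite_lattice = lattice +
  assumes finite_carrier: "finite (carrier L)"
    and nonempty_carrier: "carrier L \<noteq> {}"

definition interval_lattice :: "('a, 'b) gorder_scheme \<Rightarrow> 'a \<Rightarrow> 'a \<Rightarrow> ('a, 'b) gorder_scheme" where
  "interval_lattice L a b = L\<lparr>carrier := \<lbrace>a..b\<rbrace>\<^bsub>L\<^esub>\<rparr>"

definition covered_by :: "('a, 'b) gorder_scheme \<Rightarrow> 'a \<Rightarrow> 'a \<Rightarrow> bool" where
  "covered_by L x y \<longleftrightarrow> x \<in> carrier L \<and> y \<in> carrier L \<and> x \<sqsubset>\<^bsub>L\<^esub> y \<and>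
     \<not> (\<exists>z\<in>carrier L. x \<sqsubset>\<^bsub>L\<^esub> z \<and> z \<sqsubset>\<^bsub>L\<^esub> y)"

definition join_irreducibles :: "('a, 'b) gorder_scheme \<Rightarrow> 'a set" where
  "join_irreducibles L = {j \<in> carrier L. j \<noteq> \<bottom>\<^bsub>L\<^esub> \<and>
     (\<forall>x\<in>carrier L. \<forall>y\<in>carrier L. j = x \<squnion>\<^bsub>L\<^esub> y \<longrightarrow> j = x \<or> j = y)}"

definition meet_irreducibles :: "('a, 'b) gorder_scheme \<Rightarrow> 'a set" where
  "meet_irreducibles L = {m \<in> carrier L. m \<noteq> \<top>\<^bsub>L\<^esub> \<and>
     (\<forall>x\<in>carrier L. \<forall>y\<in>carrier L. m = x \<sqinter>\<^bsub>L\<^esub> y \<longrightarrow> m = x \<or> m = y)}"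

definition lower_cover :: "('a, 'b) gorder_scheme \<Rightarrow> 'a \<Rightarrow> 'a" where
  "lower_cover L j = (THE x. covered_by L x j)"

definition upper_cover :: "('a, 'b) gorder_scheme \<Rightarrow> 'a \<Rightarrow> 'a" where
  "upper_cover L m = (THE y. covered_by L m y)"

definition maximal_elements :: "('a, 'b) gorder_scheme \<Rightarrow> 'a set \<Rightarrow> 'a set" where
  "maximal_elements L A = {z \<in> A. \<not> (\<exists>w\<in>A. z \<sqsubset>\<^bsub>L\<^esub> w)}"

definition minimal_elements :: "('a, 'b) gorder_scheme \<Rightarrow> 'a set \<Rightarrow> 'a set" where
  "minimal_elements L A = {z \<in> A. \<not> (\<exists>w\<in>A. w \<sqsubset>\<^bsub>L\<^esub> z)}"

text \<open>
  The sets \<open>M\<^sub>L(j) = max {z \<in> L. j\<^sub>* = j \<and> z}\<close> and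
  \<open>J\<^sub>L(m) = min {z \<in> L. m\<^sup>* = m \<or> z}\<close>, where max and min denote
  the sets of all maximal and of all minimal elements.
\<close>

definition meet_partners :: "('a, 'b) gorder_scheme \<Rightarrow> 'a \<Rightarrow> 'a set" where
  "meet_partners L j = maximal_elements L {z \<in> carrier L. lower_cover L j = j \<sqinter>\<^bsub>L\<^esub> z}"

definition join_partners :: "('a, 'b) gorder_scheme \<Rightarrow> 'a \<Rightarrow> 'a set" where
  "join_partners L m = minimal_elements L {z \<in> carrier L. upper_cover L m = m \<squnion>\<^bsub>L\<^esub> z}"

text \<open>
  Pairings are functions on the join-irreducibles only; taking them extensional makes
  uniqueness of a pairing meaningful for total functions.
\<close>

definition pairings :: "('a, 'b) gorder_scheme \<Rightarrow> ('a \<Rightarrow> 'a) set" where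
  "pairings L = {\<kappa> \<in> extensional (join_irreducibles L).
     bij_betw \<kappa> (join_irreducibles L) (meet_irreducibles L) \<and>
     (\<forall>j\<in>join_irreducibles L. \<kappa> j \<in> meet_partners L j) \<and>
     (\<forall>m\<in>meet_irreducibles L. inv_into (join_irreducibles L) \<kappa> m \<in> join_partners L m)}"

definition uniquely_paired :: "('a, 'b) gorder_scheme \<Rightarrow> bool" where
  "uniquely_paired L \<longleftrightarrow> finite_lattice L \<and> (\<exists>!\<kappa>. \<kappa> \<in> pairings L)"

definition kappa :: "('a, 'b) gorder_scheme \<Rightarrow> 'a \<Rightarrow> 'a" where
  "kappa L = (THE \<kappa>. \<kappa> \<in> pairings L)"

definition kappa_inv :: "('a, 'b) gorder_scheme \<Rightarrow> 'a \<Rightarrow> 'a" where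
  "kappa_inv L = inv_into (join_irreducibles L) (kappa L)"

definition prime_pair :: "('a, 'b) gorder_scheme \<Rightarrow> 'a \<Rightarrow> 'a \<Rightarrow> bool" where
  "prime_pair L j\<^sub>0 m\<^sub>0 \<longleftrightarrow> j\<^sub>0 \<in> carrier L \<and> m\<^sub>0 \<in> carrier L \<and>
     carrier L = \<lbrace>\<bottom>\<^bsub>L\<^esub>..m\<^sub>0\<rbrace>\<^bsub>L\<^esub> \<union> \<lbrace>j\<^sub>0..\<top>\<^bsub>L\<^esub>\<rbrace>\<^bsub>L\<^esub> \<and>
     \<lbrace>\<bottom>\<^bsub>L\<^esub>..m\<^sub>0\<rbrace>\<^bsub>L\<^esub> \<inter> \<lbrace>j\<^sub>0..\<top>\<^bsub>L\<^esub>\<rbrace>\<^bsub>L\<^esub> = {}"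

text \<open>
  Both intervals of a prime pair are proper, so this inductive definition is the intended
  recursion on the size of the lattice.
\<close>

inductive compatibly_dismantlable :: "('a, 'b) gorder_scheme \<Rightarrow> bool" where
  singleton:
    "uniquely_paired L \<Longrightarrow> card (carrier L) = 1 \<Longrightarrow> compatibly_dismantlable L"
| dismantle:
    "\<lbrakk>uniquely_paired L; prime_pair L j\<^sub>0 m\<^sub>0;
      U = interval_lattice L j\<^sub>0 \<top>\<^bsub>L\<^esub>; D = interval_lattice L \<bottom>\<^bsub>L\<^esub> m\<^sub>0;
      compatibly_dismantlable U;
      bij_betw (\<lambda>j. j\<^sub>0 \<squnion>\<^bsub>L\<^esub> j)
        {j \<in> join_irreducibles L. j\<^sub>0 \<sqsubseteq>\<^bsub>L\<^esub> kappa L j} (join_irreducibles U);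
      \<forall>j\<in>join_irreducibles L. j\<^sub>0 \<sqsubseteq>\<^bsub>L\<^esub> kappa L j \<longrightarrow>
        kappa U (j\<^sub>0 \<squnion>\<^bsub>L\<^esub> j) = kappa L j;
      compatibly_dismantlable D;
      bij_betw (\<lambda>m. m\<^sub>0 \<sqinter>\<^bsub>L\<^esub> m)
        {m \<in> meet_irreducibles L. kappa_inv L m \<sqsubseteq>\<^bsub>L\<^esub> m\<^sub>0} (meet_irreducibles D);
      \<forall>m\<in>meet_irreducibles L. kappa_inv L m \<sqsubseteq>\<^bsub>L\<^esub> m\<^sub>0 \<longrightarrow>
        kappa_inv D (m\<^sub>0 \<sqinter>\<^bsub>L\<^esub> m) = kappa_inv L m\<rbrakk>
     \<Longrightarrow> compatibly_dismantlable L"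

definition J_set :: "('a, 'b) gorder_scheme \<Rightarrow> 'a \<Rightarrow> 'a set" where
  "J_set L x = {j \<in> join_irreducibles L. j \<sqsubseteq>\<^bsub>L\<^esub> x}"

definition M_set :: "('a, 'b) gorder_scheme \<Rightarrow> 'a \<Rightarrow> 'a set" where
  "M_set L x = {j \<in> join_irreducibles L. x \<sqsubseteq>\<^bsub>L\<^esub> kappa L j}"

text \<open>
  In a compatibly dismantlable lattice, \<open>M_set L x \<inter> J_set L y\<close> is a singleton whenever
  \<open>y\<close> covers \<open>x\<close>; outside this situation the label is unspecified.
\<close>

definition cover_label :: "('a, 'b) gorder_scheme \<Rightarrow> 'a \<Rightarrow> 'a \<Rightarrow> 'a" where
  "cover_label L x y = the_elem (M_set L x \<inter> J_set L y)"

definition down_labels :: "('a, 'b) gorder_scheme \<Rightarrow> 'a \<Rightarrow> 'a set" where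
  "down_labels L x = {cover_label L y x | y. covered_by L y x}"

definition up_labels :: "('a, 'b) gorder_scheme \<Rightarrow> 'a \<Rightarrow> 'a set" where
  "up_labels L x = {cover_label L x y | y. covered_by L x y}"

end

theory Submission
  imports Defs
begin

text \<open>
  If \<open>j\<close> labels a cover from \<open>x\<close> up to \<open>y\<close>, then \<open>j \<le> y\<close> but not \<open>j \<le> x\<close>, because
  \<open>x \<le> \<kappa> j\<close> while never \<open>j \<le> \<kappa> j\<close>. Hence no element covered by \<open>x\<close> is above all downward
  labels of \<open>x\<close>, so their join cannot be smaller than \<open>x\<close>; the argument for upward labels
  is dual. That every cover has exactly one label follows by induction along a prime pair
  \<open>(j\<^sub>0, m\<^sub>0)\<close>: covers inside the two intervals inherit their labels through the two
  bijections, and a cover crossing from the lower to the upper interval has \<open>j\<^sub>0\<close> as its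
  only label.
\<close>

section \<open>Suprema, infima, covers and intervals in ordered structures\<close>

lemma (in partial_order) sup_eqI: "\<Squnion>A = x" if "least L x (Upper L A)"
  unfolding Lattice.sup_def using that by (blast intro: least_unique)

lemma (in partial_order) inf_eqI: "\<Sqinter>A = x" if "greatest L x (Lower L A)"
  unfolding Lattice.inf_def using that by (blast intro: greatest_unique)

lemma covered_by_dual [simp]: "covered_by (inv_gorder L) x y \<longleftrightarrow> covered_by L y x"
  if "partial_order L"
proof -
  interpret partial_order L by fact
  interpret dual: partial_order "inv_gorder L" by (rule dual_order)
  show ?thesis
    unfolding covered_by_def dual.lless_eq lless_eq by auto
qed

text \<open>Passing to an interval only removes candidates for an element strictly in between. This
  is what lets an induction hypothesis for an interval apply to covers of the whole lattice.\<close>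

lemma covered_by_interval_lattice:
  assumes "covered_by L x y" "x \<in> \<lbrace>a..b\<rbrace>\<^bsub>L\<^esub>" "y \<in> \<lbrace>a..b\<rbrace>\<^bsub>L\<^esub>"
  shows "covered_by (interval_lattice L a b) x y"
  using assms by (auto simp: covered_by_def interval_lattice_def at_least_at_most_def lless_def)

lemma le_interval_lattice [simp]: "le (interval_lattice L a b) = le L"
  by (simp add: interval_lattice_def)

lemma uniquely_paired_kappa: "kappa L \<in> pairings L" if "uniquely_paired L"
  using that unfolding uniquely_paired_def kappa_def by (metis theI')

section \<open>Bounds and covers in finite lattices\<close>

context finite_lattice
begin

lemma finite_lattice_dual: "finite_lattice (inv_gorder L)"
  using finite_carrier nonempty_carrier dual_lattice
  by (simp add: finite_lattice_def finite_lattice_axioms_def)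

text \<open>The carrier is itself a finite nonempty set, so it has an infimum and a supremum, and
  these are the least and the greatest element.\<close>

lemma bounded_lattice: "bounded_lattice L"
proof -
  have "greatest L (\<Sqinter>(carrier L)) (Lower L (carrier L))"
    using finite_carrier nonempty_carrier by (intro finite_inf_greatest) auto
  then have "least L (\<Sqinter>(carrier L)) (carrier L)"
    by (auto simp: greatest_def least_def Lower_def)
  moreover have "least L (\<Squnion>(carrier L)) (Upper L (carrier L))"
    using finite_carrier nonempty_carrier by (intro finite_sup_least) auto
  then have "greatest L (\<Squnion>(carrier L)) (carrier L)"
    by (auto simp: greatest_def least_def Upper_def)
  ultimately show ?thesis
    by unfold_locales blast+
qed

sublocale bounded_lattice
  by (rule bounded_lattice)

lemma ex_maximal:
  assumes "A \<subseteq> carrier L" "A \<noteq> {}"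
  shows "\<exists>m\<in>A. \<forall>x\<in>A. \<not> m \<sqsubset> x"
proof -
  have "\<exists>m\<in>A. \<forall>x\<in>A. x \<noteq> m \<longrightarrow> \<not> m \<sqsubset> x"
  proof (rule Finite_Set.bex_max_element)
    show "finite A"
      using assms finite_carrier finite_subset by blast
    show "asymp_on A (\<sqsubset>)"
      using assms by (intro asymp_onI) (auto simp: lless_eq)
    show "transp_on A (\<sqsubset>)"
      using assms by (intro transp_onI) (meson lless_trans subsetD)
  qed fact
  then show ?thesis
    by (auto simp: lless_eq)
qed

text \<open>A maximal element of the interval from \<open>x\<close> to \<open>y\<close> with
  \<open>y\<close> removed is covered by \<open>y\<close>: anything strictly between it and
  \<open>y\<close> would still lie above \<open>x\<close> and contradict maximality.\<close>

lemma ex_lower_cover: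
  assumes "x \<sqsubset> y" "x \<in> carrier L" "y \<in> carrier L"
  shows "\<exists>z. covered_by L z y \<and> x \<sqsubseteq> z"
proof -
  let ?A = "{z \<in> carrier L. x \<sqsubseteq> z \<and> z \<sqsubset> y}"
  have "x \<in> ?A"
    using assms by simp
  then obtain m where m: "m \<in> ?A" "\<forall>z\<in>?A. \<not> m \<sqsubset> z"
    using ex_maximal[of ?A] by blast
  moreover have "x \<sqsubseteq> z" if "z \<in> carrier L" "m \<sqsubset> z" for z
  proof (rule le_trans)
    show "x \<sqsubseteq> m" "m \<sqsubseteq> z" "m \<in> carrier L"
      using m(1) that(2) by (auto simp: lless_eq)
  qed (use that assms in auto)
  ultimately have "covered_by L m y"
    using assms unfolding covered_by_def by blast
  with m show ?thesis
    by blast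
qed

lemma ex_upper_cover:
  assumes "x \<sqsubset> y" "x \<in> carrier L" "y \<in> carrier L"
  shows "\<exists>z. covered_by L x z \<and> z \<sqsubseteq> y"
proof -
  interpret dual: finite_lattice "inv_gorder L" by (rule finite_lattice_dual)
  have "y \<sqsubset>\<^bsub>inv_gorder L\<^esub> x"
    using assms(1) unfolding dual.lless_eq by (auto simp: lless_eq)
  from dual.ex_lower_cover[OF this] assms(2,3) show ?thesis
    by (simp add: partial_order_axioms)
qed

section \<open>Join-irreducible elements and pairings\<close>

lemma lower_cover_join_irreducible:
  assumes "j \<in> join_irreducibles L"
  shows covered_by_lower_cover: "covered_by L (lower_cover L j) j"
    and le_lower_cover: "\<And>z. z \<in> carrier L \<Longrightarrow> z \<sqsubset> j \<Longrightarrow> z \<sqsubseteq> lower_cover L j"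
proof -
  have j: "j \<in> carrier L" "j \<noteq> \<bottom>"
    and irr: "\<And>x y. x \<in> carrier L \<Longrightarrow> y \<in> carrier L \<Longrightarrow> j = x \<squnion> y \<Longrightarrow> j = x \<or> j = y"
    using assms by (auto simp: join_irreducibles_def)
  have "\<bottom> \<sqsubset> j"
    using j by (simp add: lless_eq)
  then obtain c where c: "covered_by L c j"
    using ex_lower_cover j by blast
  then have cc: "c \<in> carrier L" "c \<sqsubset> j" "\<And>z. z \<in> carrier L \<Longrightarrow> c \<sqsubset> z \<Longrightarrow> \<not> z \<sqsubset> j"
    by (auto simp: covered_by_def)
  \<comment> \<open>Neither \<open>c\<close> nor \<open>z\<close> equals \<open>j\<close>, so
    irreducibility keeps \<open>c \<squnion> z\<close> strictly below \<open>j\<close>; as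
    \<open>j\<close> covers \<open>c\<close>, this join is \<open>c\<close> itself.\<close>
  have below: "z \<sqsubseteq> c" if z: "z \<in> carrier L" "z \<sqsubset> j" for z
  proof -
    have "c \<squnion> z \<sqsubset> j"
      using irr[of c z] z cc j by (auto simp: lless_eq intro!: join_le)
    then have "c \<squnion> z = c"
      using cc z join_left[of c z] by (auto simp: lless_eq)
    then show ?thesis
      using join_right[of c z] z cc by simp
  qed
  \<comment> \<open>Any lower cover \<open>d\<close> of \<open>j\<close> lies below \<open>c\<close>
    by \<open>below\<close>, hence equals \<open>c\<close>; so the description \<open>THE\<close> in
    \<open>lower_cover\<close> denotes \<open>c\<close>.\<close>
  have "lower_cover L j = c"
    unfolding lower_cover_def
  proof (rule the_equality)
    show "d = c" if "covered_by L d j" for d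
      using that below cc unfolding covered_by_def lless_eq by metis
  qed fact
  then show "covered_by L (lower_cover L j) j"
    and "\<And>z. z \<in> carrier L \<Longrightarrow> z \<sqsubset> j \<Longrightarrow> z \<sqsubseteq> lower_cover L j"
    using c below by auto
qed

text \<open>Everything is read off from the equation
  \<open>lower_cover L j = j \<sqinter> \<kappa> j\<close>: if \<open>j\<close> were below
  \<open>\<kappa> j\<close>, the meet would be \<open>j\<close>, which is not its own lower
  cover.\<close>

lemma pairing_join_irreducible:
  assumes "\<kappa> \<in> pairings L" "j \<in> join_irreducibles L"
  shows pairing_closed: "\<kappa> j \<in> carrier L"
    and lower_cover_le_pairing: "lower_cover L j \<sqsubseteq> \<kappa> j"
    and not_le_pairing: "\<not> j \<sqsubseteq> \<kappa> j"
proof -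
  have "\<kappa> j \<in> meet_partners L j" and j: "j \<in> carrier L"
    using assms by (auto simp: pairings_def join_irreducibles_def)
  then have \<kappa>: "\<kappa> j \<in> carrier L" "lower_cover L j = j \<sqinter> \<kappa> j"
    by (auto simp: meet_partners_def maximal_elements_def)
  then show "\<kappa> j \<in> carrier L" "lower_cover L j \<sqsubseteq> \<kappa> j"
    using meet_right j by auto
  have "lower_cover L j \<noteq> j"
    using covered_by_lower_cover[OF assms(2)] by (auto simp: covered_by_def lless_eq)
  then show "\<not> j \<sqsubseteq> \<kappa> j"
    using le_iff_join[OF j \<kappa>(1)] \<kappa>(2) by auto
qed

section \<open>Prime pairs\<close>

lemma prime_pair_cases:
  assumes "prime_pair L j\<^sub>0 m\<^sub>0" "z \<in> carrier L"
  shows "j\<^sub>0 \<sqsubseteq> z \<longleftrightarrow> \<not> z \<sqsubseteq> m\<^sub>0"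
proof -
  have "z \<in> \<lbrace>\<bottom>..m\<^sub>0\<rbrace> \<longleftrightarrow> z \<notin> \<lbrace>j\<^sub>0..\<top>\<rbrace>"
    using assms unfolding prime_pair_def by blast
  then show ?thesis
    using assms(2) by (auto simp: at_least_at_most_def)
qed

text \<open>In fact \<open>j\<^sub>0\<close> is join-prime: elements not above
  \<open>j\<^sub>0\<close> are exactly those below \<open>m\<^sub>0\<close>, and these are closed
  under joins.\<close>

lemma prime_pair_join_irreducible:
  assumes "prime_pair L j\<^sub>0 m\<^sub>0"
  shows "j\<^sub>0 \<in> join_irreducibles L"
proof -
  have c: "j\<^sub>0 \<in> carrier L" "m\<^sub>0 \<in> carrier L"
    using assms by (auto simp: prime_pair_def)
  have "j\<^sub>0 \<noteq> \<bottom>"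
    using prime_pair_cases[OF assms, of \<bottom>] c by auto
  moreover have "j\<^sub>0 = x \<or> j\<^sub>0 = y"
    if "x \<in> carrier L" "y \<in> carrier L" "j\<^sub>0 = x \<squnion> y" for x y
  proof -
    have "\<not> x \<squnion> y \<sqsubseteq> m\<^sub>0"
      using prime_pair_cases[OF assms c(1)] c that by simp
    then have "j\<^sub>0 \<sqsubseteq> x \<or> j\<^sub>0 \<sqsubseteq> y"
      using prime_pair_cases[OF assms] that c by (meson join_le)
    moreover have "x \<sqsubseteq> j\<^sub>0" "y \<sqsubseteq> j\<^sub>0"
      using that join_left join_right by auto
    ultimately show ?thesis
      using c that by (metis le_antisym)
  qed
  ultimately show ?thesis
    using c by (auto simp: join_irreducibles_def)
qed

text \<open>The element \<open>m\<^sub>0\<close> is the largest one not above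
  \<open>j\<^sub>0\<close>, so \<open>\<kappa> j\<^sub>0\<close> lies below it. Since
  \<open>m\<^sub>0\<close> also satisfies the equation in \<open>meet_partners\<close>, maximality
  of \<open>\<kappa> j\<^sub>0\<close> forces equality.\<close>

lemma prime_pair_pairing:
  assumes "prime_pair L j\<^sub>0 m\<^sub>0" "\<kappa> \<in> pairings L"
  shows "\<kappa> j\<^sub>0 = m\<^sub>0"
proof -
  have c: "j\<^sub>0 \<in> carrier L" "m\<^sub>0 \<in> carrier L"
    using assms by (auto simp: prime_pair_def)
  note irr = prime_pair_join_irreducible[OF assms(1)]
  note cover = covered_by_lower_cover[OF irr]
  have \<kappa>: "\<kappa> j\<^sub>0 \<in> carrier L" "\<kappa> j\<^sub>0 \<sqsubseteq> m\<^sub>0"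
    using pairing_join_irreducible[OF assms(2) irr] prime_pair_cases[OF assms(1)] by auto
  have lc: "lower_cover L j\<^sub>0 \<in> carrier L" "lower_cover L j\<^sub>0 \<sqsubset> j\<^sub>0"
    using cover by (auto simp: covered_by_def)
  then have "lower_cover L j\<^sub>0 \<sqsubseteq> m\<^sub>0"
    using prime_pair_cases[OF assms(1) lc(1)] c by (auto simp: lless_eq)
  moreover have "\<not> j\<^sub>0 \<sqsubseteq> m\<^sub>0"
    using prime_pair_cases[OF assms(1) c(1)] c by simp
  then have "j\<^sub>0 \<sqinter> m\<^sub>0 \<sqsubset> j\<^sub>0"
    using le_iff_join[OF c] meet_left[OF c] by (auto simp: lless_eq)
  then have "j\<^sub>0 \<sqinter> m\<^sub>0 \<sqsubseteq> lower_cover L j\<^sub>0"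
    using le_lower_cover[OF irr] c by simp
  ultimately have "lower_cover L j\<^sub>0 = j\<^sub>0 \<sqinter> m\<^sub>0"
    using lc c by (auto simp: lless_eq intro!: le_antisym meet_le)
  moreover have "\<kappa> j\<^sub>0 \<in> meet_partners L j\<^sub>0"
    using assms(2) irr by (auto simp: pairings_def)
  ultimately have "\<not> \<kappa> j\<^sub>0 \<sqsubset> m\<^sub>0"
    using c by (auto simp: meet_partners_def maximal_elements_def)
  with \<kappa> show ?thesis
    by (auto simp: lless_eq)
qed

section \<open>Labels of a cover in relation to a prime pair\<close>

lemma ex1_label_crossing:
  assumes "uniquely_paired L" "prime_pair L j\<^sub>0 m\<^sub>0" "covered_by L x y"
    and "x \<sqsubseteq> m\<^sub>0" "j\<^sub>0 \<sqsubseteq> y"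
  shows "\<exists>!j. j \<in> M_set L x \<inter> J_set L y"
proof
  note pairing = uniquely_paired_kappa[OF assms(1)]
  note irr = prime_pair_join_irreducible[OF assms(2)]
  have c: "j\<^sub>0 \<in> carrier L" "m\<^sub>0 \<in> carrier L"
    using assms by (auto simp: prime_pair_def)
  have xy: "x \<in> carrier L" "y \<in> carrier L" "x \<sqsubset> y"
    and cover: "\<And>z. z \<in> carrier L \<Longrightarrow> x \<sqsubset> z \<Longrightarrow> \<not> z \<sqsubset> y"
    using assms by (auto simp: covered_by_def)
  \<comment> \<open>The partner of \<open>j\<^sub>0\<close> is \<open>m\<^sub>0\<close>, so the two
    conditions on a label are exactly the crossing assumptions.\<close>
  show "j\<^sub>0 \<in> M_set L x \<inter> J_set L y"
    using irr assms prime_pair_pairing[OF assms(2) pairing] by (simp add: M_set_def J_set_def)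
  fix j assume "j \<in> M_set L x \<inter> J_set L y"
  then have j: "j \<in> join_irreducibles L" "j \<in> carrier L" "x \<sqsubseteq> kappa L j" "j \<sqsubseteq> y"
    by (auto simp: M_set_def J_set_def join_irreducibles_def)
  note \<kappa> = pairing_join_irreducible[OF pairing j(1)]
  \<comment> \<open>Since \<open>j\<^sub>0\<close> is not below \<open>x\<close>, the cover forces
    \<open>x \<squnion> j\<^sub>0 = y\<close>. Were \<open>j\<^sub>0\<close> below
    \<open>kappa L j\<close>, then \<open>y\<close>, and with it \<open>j\<close>, would be
    too.\<close>
  have \<kappa>_le: "\<not> j\<^sub>0 \<sqsubseteq> kappa L j"
  proof
    assume "j\<^sub>0 \<sqsubseteq> kappa L j"
    then have le: "x \<squnion> j\<^sub>0 \<sqsubseteq> kappa L j"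
      using j c xy \<kappa> by (simp add: join_le)
    have "\<not> j\<^sub>0 \<sqsubseteq> x"
      using prime_pair_cases[OF assms(2)] assms xy by simp
    then have "x \<sqsubset> x \<squnion> j\<^sub>0"
      using join_left[of x j\<^sub>0] join_right[of x j\<^sub>0] xy c by (auto simp: lless_eq)
    moreover have "x \<squnion> j\<^sub>0 \<sqsubseteq> y"
      using xy c assms by (auto simp: lless_eq intro!: join_le)
    ultimately have "x \<squnion> j\<^sub>0 = y"
      using cover[of "x \<squnion> j\<^sub>0"] xy c by (auto simp: lless_eq)
    then show False
      using le j \<kappa> xy by (meson le_trans)
  qed
  \<comment> \<open>Dually \<open>m\<^sub>0 \<sqinter> y = x\<close>, so \<open>j\<close> below
    \<open>m\<^sub>0\<close> would give
    \<open>j \<sqsubseteq> x \<sqsubseteq> kappa L j\<close>.\<close>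
  have "\<not> j \<sqsubseteq> m\<^sub>0"
  proof
    assume "j \<sqsubseteq> m\<^sub>0"
    then have le: "j \<sqsubseteq> m\<^sub>0 \<sqinter> y"
      using j c xy by (simp add: meet_le)
    have "\<not> y \<sqsubseteq> m\<^sub>0"
      using prime_pair_cases[OF assms(2)] assms xy by simp
    then have "m\<^sub>0 \<sqinter> y \<sqsubset> y"
      using meet_left[of m\<^sub>0 y] meet_right[of m\<^sub>0 y] xy c by (auto simp: lless_eq)
    moreover have "x \<sqsubseteq> m\<^sub>0 \<sqinter> y"
      using xy c assms by (auto simp: lless_eq intro!: meet_le)
    ultimately have "m\<^sub>0 \<sqinter> y = x"
      using cover[of "m\<^sub>0 \<sqinter> y"] xy c by (auto simp: lless_eq)
    then show False
      using le j \<kappa> xy by (meson le_trans)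
  qed
  then have "j\<^sub>0 \<sqsubseteq> j"
    using prime_pair_cases[OF assms(2) j(2)] by simp
  \<comment> \<open>An element strictly below \<open>j\<close> lies below its lower cover and hence
    below \<open>kappa L j\<close>, which \<open>\<kappa>_le\<close> rules out for
    \<open>j\<^sub>0\<close>.\<close>
  moreover have "\<not> j\<^sub>0 \<sqsubset> j"
  proof
    assume "j\<^sub>0 \<sqsubset> j"
    then have "j\<^sub>0 \<sqsubseteq> lower_cover L j"
      using le_lower_cover[OF j(1)] c by simp
    moreover have "lower_cover L j \<in> carrier L"
      using covered_by_lower_cover[OF j(1)] by (simp add: covered_by_def)
    ultimately show False
      using \<kappa>_le \<kappa> c by (meson le_trans)
  qed
  ultimately show "j = j\<^sub>0"
    by (auto simp: lless_eq)
qed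

text \<open>The map \<open>j \<mapsto> j\<^sub>0 \<squnion> j\<close> carries labels in
  \<open>L\<close> bijectively to labels in \<open>U\<close>: it preserves partners, and joining
  with \<open>j\<^sub>0\<close> does not affect being below \<open>y\<close>. Every label in
  \<open>L\<close> is in its domain because
  \<open>j\<^sub>0 \<sqsubseteq> x \<sqsubseteq> kappa L j\<close>.\<close>

lemma ex1_label_upper:
  fixes j\<^sub>0
  defines "U \<equiv> interval_lattice L j\<^sub>0 \<top>"
  assumes "uniquely_paired L" "j\<^sub>0 \<in> carrier L" "x \<in> carrier L" "y \<in> carrier L"
    and "j\<^sub>0 \<sqsubseteq> x" "j\<^sub>0 \<sqsubseteq> y"
    and bij: "bij_betw (\<lambda>j. j\<^sub>0 \<squnion> j) {j \<in> join_irreducibles L. j\<^sub>0 \<sqsubseteq> kappa L j} (join_irreducibles U)"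
    and \<kappa>: "\<forall>j\<in>join_irreducibles L. j\<^sub>0 \<sqsubseteq> kappa L j \<longrightarrow> kappa U (j\<^sub>0 \<squnion> j) = kappa L j"
    and ex1: "\<exists>!j. j \<in> M_set U x \<inter> J_set U y"
  shows "\<exists>!j. j \<in> M_set L x \<inter> J_set L y"
proof -
  let ?A = "{j \<in> join_irreducibles L. j\<^sub>0 \<sqsubseteq> kappa L j}"
  have label_iff: "j\<^sub>0 \<squnion> j \<in> M_set U x \<inter> J_set U y \<longleftrightarrow> j \<in> M_set L x \<inter> J_set L y" if "j \<in> ?A" for j
  proof -
    have "j \<in> carrier L"
      using that by (simp add: join_irreducibles_def)
    then have "j\<^sub>0 \<squnion> j \<sqsubseteq> y \<longleftrightarrow> j \<sqsubseteq> y"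
      using assms by (meson join_closed join_le join_right le_trans)
    moreover have "j\<^sub>0 \<squnion> j \<in> join_irreducibles U"
      using bij that by (auto simp: bij_betw_def)
    ultimately show ?thesis
      using that \<kappa> by (simp add: M_set_def J_set_def U_def)
  qed
  have label_A: "j \<in> ?A" if "j \<in> M_set L x" for j
    using that assms pairing_closed[OF uniquely_paired_kappa[OF \<open>uniquely_paired L\<close>]]
    by (auto simp: M_set_def intro: le_trans)
  obtain u where u: "u \<in> M_set U x \<inter> J_set U y" "\<forall>v. v \<in> M_set U x \<inter> J_set U y \<longrightarrow> v = u"
    using ex1 by (rule ex1E)
  \<comment> \<open>Surjectivity pulls the label \<open>u\<close> back to a label in
    \<open>L\<close>; injectivity will show that there is no second one.\<close>
  from u(1) have "u \<in> (\<lambda>j. j\<^sub>0 \<squnion> j) ` ?A"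
    unfolding bij_betw_imp_surj_on[OF bij] by (simp add: M_set_def)
  then obtain j where j: "j \<in> ?A" "u = j\<^sub>0 \<squnion> j"
    by blast
  show ?thesis
  proof
    show "j \<in> M_set L x \<inter> J_set L y"
      using label_iff[OF j(1)] j(2) u(1) by simp
    fix i assume i: "i \<in> M_set L x \<inter> J_set L y"
    then have iA: "i \<in> ?A"
      using label_A by simp
    then have "j\<^sub>0 \<squnion> i = j\<^sub>0 \<squnion> j"
      using label_iff[OF iA] i j(2) u(2) by metis
    then show "i = j"
      using bij_betw_imp_inj_on[OF bij] iA j(1) by (simp add: inj_on_eq_iff)
  qed
qed

text \<open>Here the labels themselves stay the same. Read through the two pairings, the bijection
  on meet-irreducibles says that the join-irreducibles of \<open>D\<close> are those of
  \<open>L\<close> below \<open>m\<^sub>0\<close>, with partner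
  \<open>m\<^sub>0 \<sqinter> kappa L j\<close>. As \<open>x\<close> is below
  \<open>m\<^sub>0\<close>, meeting with \<open>m\<^sub>0\<close> does not change which partners lie
  above \<open>x\<close>.\<close>

lemma ex1_label_lower:
  fixes m\<^sub>0
  defines "D \<equiv> interval_lattice L \<bottom> m\<^sub>0"
  assumes "uniquely_paired L" "uniquely_paired D"
    and "m\<^sub>0 \<in> carrier L" "x \<in> carrier L" "y \<in> carrier L" "x \<sqsubseteq> m\<^sub>0" "y \<sqsubseteq> m\<^sub>0"
    and bij: "bij_betw (\<lambda>m. m\<^sub>0 \<sqinter> m) {m \<in> meet_irreducibles L. kappa_inv L m \<sqsubseteq> m\<^sub>0}
      (meet_irreducibles D)"
    and \<kappa>: "\<forall>m\<in>meet_irreducibles L. kappa_inv L m \<sqsubseteq> m\<^sub>0 \<longrightarrow>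
      kappa_inv D (m\<^sub>0 \<sqinter> m) = kappa_inv L m"
    and ex1: "\<exists>!j. j \<in> M_set D x \<inter> J_set D y"
  shows "\<exists>!j. j \<in> M_set L x \<inter> J_set L y"
proof -
  let ?A = "{j \<in> join_irreducibles L. j \<sqsubseteq> m\<^sub>0}"
  let ?B = "{m \<in> meet_irreducibles L. kappa_inv L m \<sqsubseteq> m\<^sub>0}"
  have bij_L: "bij_betw (kappa L) (join_irreducibles L) (meet_irreducibles L)"
    and bij_D: "bij_betw (kappa D) (join_irreducibles D) (meet_irreducibles D)"
    using assms uniquely_paired_kappa by (auto simp: pairings_def)
  have inv_L: "kappa_inv L (kappa L j) = j" if "j \<in> join_irreducibles L" for j
    using bij_L that by (simp add: kappa_inv_def bij_betw_inv_into_left)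
  \<comment> \<open>The bijection applies to \<open>kappa L j\<close>, whose inverse image
    \<open>j\<close> is below \<open>m\<^sub>0\<close>. Its image is a meet-irreducible of
    \<open>D\<close>, so \<open>kappa_inv D\<close> sends it to a join-irreducible of
    \<open>D\<close>, namely \<open>j\<close>, and \<open>kappa D\<close> sends \<open>j\<close>
    back.\<close>
  have transfer: "j \<in> join_irreducibles D" "kappa D j = m\<^sub>0 \<sqinter> kappa L j" if "j \<in> ?A" for j
  proof -
    have m: "kappa L j \<in> ?B"
      using that inv_L bij_L by (auto simp: bij_betw_def)
    then have "m\<^sub>0 \<sqinter> kappa L j \<in> meet_irreducibles D" "kappa_inv D (m\<^sub>0 \<sqinter> kappa L j) = j"
      using bij \<kappa> inv_L that by (auto simp: bij_betw_def)
    then show "j \<in> join_irreducibles D" "kappa D j = m\<^sub>0 \<sqinter> kappa L j"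
      using bij_betw_imp_surj_on[OF bij_D] unfolding kappa_inv_def
      by (metis inv_into_into, metis f_inv_into_f)
  qed
  have label_iff: "j \<in> M_set D x \<inter> J_set D y \<longleftrightarrow> j \<in> M_set L x \<inter> J_set L y" if "j \<in> ?A" for j
  proof -
    have "kappa L j \<in> carrier L"
      using that pairing_closed[OF uniquely_paired_kappa] assms(2) by blast
    then have "x \<sqsubseteq> m\<^sub>0 \<sqinter> kappa L j \<longleftrightarrow> x \<sqsubseteq> kappa L j"
      using assms by (meson meet_closed meet_le meet_right le_trans)
    then show ?thesis
      using that transfer by (simp add: M_set_def J_set_def D_def)
  qed
  have A_L: "j \<in> ?A" if "j \<in> J_set L y" for j
    using that assms by (auto simp: J_set_def join_irreducibles_def intro: le_trans)
  \<comment> \<open>Conversely, surjectivity writes \<open>kappa D j\<close> as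
    \<open>m\<^sub>0 \<sqinter> m\<close>, and compatibility of the inverses identifies
    \<open>j\<close> with \<open>kappa_inv L m\<close>.\<close>
  have A_D: "j \<in> ?A" if "j \<in> join_irreducibles D" for j
  proof -
    have "kappa D j \<in> meet_irreducibles D"
      using that bij_D by (auto simp: bij_betw_def)
    then have "kappa D j \<in> (\<lambda>m. m\<^sub>0 \<sqinter> m) ` ?B"
      using bij by (simp add: bij_betw_def)
    then obtain m where m: "m \<in> ?B" "kappa D j = m\<^sub>0 \<sqinter> m"
      by blast
    then have "j = kappa_inv L m"
      using \<kappa> bij_D that by (metis (no_types, lifting) kappa_inv_def bij_betw_inv_into_left mem_Collect_eq)
    then show ?thesis
      using m bij_L by (auto simp: kappa_inv_def bij_betw_def inv_into_into)
  qed
  have "M_set D x \<inter> J_set D y = M_set L x \<inter> J_set L y"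
  proof (rule Set.set_eqI)
    fix j
    show "j \<in> M_set D x \<inter> J_set D y \<longleftrightarrow> j \<in> M_set L x \<inter> J_set L y"
    proof (cases "j \<in> ?A")
      case False
      then have "j \<notin> J_set L y" "j \<notin> J_set D y"
        using A_L[of j] A_D[of j] by (auto simp: J_set_def)
      then show ?thesis
        by simp
    qed (rule label_iff)
  qed
  then show ?thesis
    using ex1 by simp
qed

end

section \<open>Existence and uniqueness of labels by induction\<close>

lemma compatibly_dismantlable_uniquely_paired:
  "uniquely_paired L" if "compatibly_dismantlable L"
  using that by (rule compatibly_dismantlable.induct)

lemma ex1_label:
  assumes "compatibly_dismantlable L" "covered_by L x y"
  shows "\<exists>!j. j \<in> M_set L x \<inter> J_set L y"
  using assms
proof (induction arbitrary: x y)
  case (singleton L)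
  then interpret finite_lattice L
    by (simp add: uniquely_paired_def)
  have "x = y"
    using singleton by (auto simp: covered_by_def card_1_singleton_iff)
  then show ?case
    using singleton by (simp add: covered_by_def lless_eq)
next
  case (dismantle L j\<^sub>0 m\<^sub>0 U D)
  then interpret finite_lattice L
    by (simp add: uniquely_paired_def)
  note pp = \<open>prime_pair L j\<^sub>0 m\<^sub>0\<close>
  have c: "j\<^sub>0 \<in> carrier L" "m\<^sub>0 \<in> carrier L"
    using pp by (auto simp: prime_pair_def)
  have xy: "x \<in> carrier L" "y \<in> carrier L" "x \<sqsubseteq>\<^bsub>L\<^esub> y"
    using dismantle.prems by (auto simp: covered_by_def lless_eq)
  \<comment> \<open>A cover cannot descend from the upper interval into the lower one, so it lies in
    one of them or crosses upwards.\<close>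
  consider "j\<^sub>0 \<sqsubseteq>\<^bsub>L\<^esub> x" | "y \<sqsubseteq>\<^bsub>L\<^esub> m\<^sub>0" | "x \<sqsubseteq>\<^bsub>L\<^esub> m\<^sub>0" "j\<^sub>0 \<sqsubseteq>\<^bsub>L\<^esub> y"
    using prime_pair_cases[OF pp] xy by blast
  then show ?case
  proof cases
    case 1
    then have le: "j\<^sub>0 \<sqsubseteq>\<^bsub>L\<^esub> y"
      using xy c by (meson le_trans)
    have "covered_by U x y"
      unfolding dismantle.hyps using 1 le xy dismantle.prems
      by (intro covered_by_interval_lattice) (auto simp: at_least_at_most_def)
    from dismantle.IH(1)[OF this] show ?thesis
      using dismantle.hyps 1 le xy c by (intro ex1_label_upper[of j\<^sub>0]) auto
  next
    case 2
    then have le: "x \<sqsubseteq>\<^bsub>L\<^esub> m\<^sub>0"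
      using xy c by (meson le_trans)
    have "covered_by D x y"
      unfolding dismantle.hyps using 2 le xy dismantle.prems
      by (intro covered_by_interval_lattice) (auto simp: at_least_at_most_def)
    from dismantle.IH(2)[OF this] show ?thesis
      using dismantle.hyps compatibly_dismantlable_uniquely_paired[of D] 2 le xy c
      by (intro ex1_label_lower[of m\<^sub>0]) auto
  next
    case 3
    then show ?thesis
      using ex1_label_crossing dismantle.hyps(1,2) dismantle.prems by blast
  qed
qed

text \<open>Unique existence makes the intersection a singleton, the case in which
  \<open>the_elem\<close> has a specified value.\<close>

lemma cover_label:
  assumes "compatibly_dismantlable L" "covered_by L x y"
  shows "cover_label L x y \<in> M_set L x \<inter> J_set L y"
proof -
  obtain j where "j \<in> M_set L x \<inter> J_set L y" "\<forall>i. i \<in> M_set L x \<inter> J_set L y \<longrightarrow> i = j"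
    using ex1_label[OF assms] by (rule ex1E)
  then have "M_set L x \<inter> J_set L y = {j}"
    by blast
  then show ?thesis
    by (simp add: cover_label_def)
qed

section \<open>Recovering an element from its labels\<close>

context finite_lattice
begin

context
  assumes dismantlable: "compatibly_dismantlable L"
begin

lemma pairing_kappa: "kappa L \<in> pairings L"
  using compatibly_dismantlable_uniquely_paired[OF dismantlable] by (rule uniquely_paired_kappa)

text \<open>Both \<open>j\<close> and its partner separate the ends of the cover: \<open>j\<close>
  is below \<open>y\<close> but not \<open>x\<close>, and \<open>kappa L j\<close> is above
  \<open>x\<close> but not \<open>y\<close>.\<close>

lemma cover_label_props:
  assumes "covered_by L x y"
  defines "j \<equiv> cover_label L x y"
  shows "j \<in> carrier L" "kappa L j \<in> carrier L" "\<not> j \<sqsubseteq> kappa L j" "j \<sqsubseteq> y" "x \<sqsubseteq> kappa L j"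
proof -
  have "j \<in> join_irreducibles L" "j \<sqsubseteq> y" "x \<sqsubseteq> kappa L j"
    using cover_label[OF dismantlable assms(1)] by (auto simp: j_def M_set_def J_set_def)
  then show "j \<in> carrier L" "kappa L j \<in> carrier L" "\<not> j \<sqsubseteq> kappa L j" "j \<sqsubseteq> y" "x \<sqsubseteq> kappa L j"
    using pairing_join_irreducible[OF pairing_kappa] by (auto simp: join_irreducibles_def)
qed

text \<open>The bottom element has no lower covers, so its label set is empty with supremum
  \<open>\<bottom>\<close>; the argument treats this case uniformly with the others.\<close>

lemma sup_down_labels:
  assumes x: "x \<in> carrier L"
  shows "\<Squnion>(down_labels L x) = x"
proof (rule sup_eqI)
  have "x \<sqsubseteq> u" if u: "u \<in> Upper L (down_labels L x)" for u
  proof (rule ccontr)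
    assume "\<not> x \<sqsubseteq> u"
    have uc: "u \<in> carrier L"
      using u by (simp add: Upper_def)
    \<comment> \<open>Meeting with \<open>x\<close> turns \<open>\<not> x \<sqsubseteq> u\<close>
      into a strict inequality, which yields a cover of \<open>y\<close> by \<open>x\<close> with
      \<open>y\<close> above \<open>x \<sqinter> u\<close>. Its label is below both \<open>x\<close>
      and \<open>u\<close>, hence below \<open>y\<close> and its own partner.\<close>
    have "x \<sqinter> u \<sqsubset> x"
      using \<open>\<not> x \<sqsubseteq> u\<close> le_iff_join[OF x uc] meet_left[OF x uc] by (auto simp: lless_eq)
    then obtain y where y: "covered_by L y x" "x \<sqinter> u \<sqsubseteq> y"
      using ex_lower_cover[of "x \<sqinter> u" x] x uc by auto
    define j where "j = cover_label L y x"
    note j = cover_label_props[OF y(1), folded j_def]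
    have "j \<sqsubseteq> u"
      using u j y by (auto simp: Upper_def down_labels_def j_def)
    then have "j \<sqsubseteq> x \<sqinter> u"
      using j x uc by (simp add: meet_le)
    moreover have "y \<in> carrier L"
      using y by (simp add: covered_by_def)
    ultimately show False
      using y j x uc by (meson le_trans meet_closed)
  qed
  then show "least L x (Upper L (down_labels L x))"
    using x cover_label_props(4)
    by (auto simp: least_def Upper_def down_labels_def)
qed

lemma inf_kappa_up_labels:
  assumes x: "x \<in> carrier L"
  shows "\<Sqinter>(kappa L ` up_labels L x) = x"
proof (rule inf_eqI)
  have "u \<sqsubseteq> x" if u: "u \<in> Lower L (kappa L ` up_labels L x)" for u
  proof (rule ccontr)
    assume "\<not> u \<sqsubseteq> x"
    have uc: "u \<in> carrier L"
      using u by (simp add: Lower_def)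
    \<comment> \<open>Dually, this yields a cover \<open>y\<close> of \<open>x\<close> below
      \<open>u \<squnion> x\<close>. The partner of its label is above both \<open>u\<close> and
      \<open>x\<close>, hence above \<open>y\<close> and the label itself.\<close>
    have "x \<sqsubset> u \<squnion> x"
      using \<open>\<not> u \<sqsubseteq> x\<close> le_iff_meet[OF uc x] join_right[OF uc x] by (auto simp: lless_eq)
    then obtain y where y: "covered_by L x y" "y \<sqsubseteq> u \<squnion> x"
      using ex_upper_cover[of x "u \<squnion> x"] x uc by auto
    define j where "j = cover_label L x y"
    note j = cover_label_props[OF y(1), folded j_def]
    have "kappa L j \<in> kappa L ` up_labels L x"
      using y by (auto simp: up_labels_def j_def)
    then have "u \<sqsubseteq> kappa L j"
      using u j(2) by (simp add: Lower_def)
    then have "u \<squnion> x \<sqsubseteq> kappa L j"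
      using j x uc by (simp add: join_le)
    moreover have "y \<in> carrier L"
      using y by (simp add: covered_by_def)
    ultimately show False
      using y j x uc by (meson le_trans join_closed)
  qed
  then show "greatest L x (Lower L (kappa L ` up_labels L x))"
    using x cover_label_props(5)
    by (auto simp: greatest_def Lower_def up_labels_def)
qed

end

end

theorem theorem5p6:
  fixes L :: "('a, 'b) gorder_scheme"
  assumes "finite_lattice L"
    and "compatibly_dismantlable L"
  shows "inj_on (down_labels L) (carrier L) \<and>
    inj_on (up_labels L) (carrier L) \<and>
    (\<forall>x\<in>carrier L. x = \<Squnion>\<^bsub>L\<^esub> (down_labels L x) \<and>
      x = \<Sqinter>\<^bsub>L\<^esub> (kappa L ` up_labels L x))"
proof -
  note down = finite_lattice.sup_down_labels[OF assms]
  note up = finite_lattice.inf_kappa_up_labels[OF assms]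
  \<comment> \<open>The two formulas provide left inverses of the labelling maps: the supremum for
    \<open>down_labels L\<close>, and the infimum after applying \<open>kappa L\<close> for
    \<open>up_labels L\<close>.\<close>
  have "inj_on (down_labels L) (carrier L)"
    by (rule inj_on_inverseI) (rule down)
  moreover have "inj_on (up_labels L) (carrier L)"
    by (rule inj_on_inverseI[where g = "\<lambda>S. \<Sqinter>\<^bsub>L\<^esub> (kappa L ` S)"]) (rule up)
  ultimately show ?thesis
    using down up by simp
qed

end
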